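(* The following inclusions hold: (a) $V^{(1)}(m)\subseteq\dots\subseteq V^{(i)}(m)$ for each $1\le i\le\mathfrak n$ and $m\in M^{(i)}$. (b) $V^{(i)}(m)\subseteq V^{(j)}(n)$ for all $1\le i<j\le\mathfrak n$, $n\in M^{(j)}$ and $m\in M^{(i)}\cap V^{(j)}(n)$.
   Context: **Setting.** $\mathcal S$ is a finite set, $E:\mathcal S\to\mathbb R$ satisfies $E(r)\ne E(s)$ for $r\ne s$, and $(p(r,s))_{r,s\in\mathcal S}$ is an irreducible transition matrix with $p(s,s)>0$ and $p(r,s)>0\iff p(s,r)>0$. Distinct $r,s$ are neighbours, $r\sim s$, if $p(r,s)>0$. **Essential saddles.** For $r\neq s$, $\Gamma(r,s)$ is the set of self-avoiding paths $(\gamma_0,\dots,\gamma_k)$ with $\gamma_0=r$, $\gamma_k=s$, $p(\gamma_l,\gamma_{l+1})>0$. A path in $\Gamma(r,s)$ is minimal if its maximal energy $\max_l E(\gamma_l)$ is minimal within $\Gamma(r,s)$. The essential saddle $z^*(r,s)$ is the state of maximal energy on any minimal path from $r$ to $s$ (well defined since $E$ is injective); $z^*(s,s):=s$. **Metastable states.** $M^{(1)}:=\{s: E(s)<E(r)\text{ for all }r\sim s\}$, $\mathfrak n:=|M^{(1)}|$. For $1\le i<\mathfrak n$, $M^{(i+1)}:=M^{(i)}\setminus\{m^{(i)}\}$, where $m^{(i)}$ is the $m\in M^{(i)}$ with minimal activation energy $\min_{n\in M^{(i)}\setminus\{m\}}E(z^*(m,n))-E(m)$ for a transition to another element of $M^{(i)}$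 (ties broken arbitrarily); $m^{(\mathfrak n)}$ is the last remaining element. So $M^{(i)}=\{m^{(i)},\dots,m^{(\mathfrak n)}\}$. **Attraction.** For $m\in M^{(i)}$, $V^{(i)}_<(m):=\{s: E(z^*(s,m))<E(z^*(s,m'))\ \forall m'\in M^{(i)}\setminus\{m\}\}$. State $s$ is attracted by $m$ at level $i$ ($s\leadsto m$ at level $i$) if $E(z^*(s,m))=\min_{n\in M^{(i)}}E(z^*(s,n))$ and every minimal path from $s$ to any $m'\in M^{(i)}\setminus\{m\}$ with $E(z^*(s,m'))=E(z^*(s,m))$ hits $V^{(i)}_<(m)$. Let $l(i):=\inf\{j: i<j\le\mathfrak n,\ m^{(i)}\leadsto m\text{ at level }j\text{ for some }m\in M^{(j)}\}$ ($\inf\emptyset=\infty$). **Valleys.** $V^{(1)}(m):=\{s: s\leadsto m\text{ at level }1\}$ for $m\in M^{(1)}$, $N^{(1)}:=(\bigcup_{j=1}^{\mathfrak n}V^{(1)}(m^{(j)}))^c$. For $2\le i\le\mathfrak n$, $m\in M^{(i)}$: $V^{(i)}(m):=V^{(i-1)}(m)\cup\{s\in N^{(i-1)}: s\leadsto m\text{ at level }i\}\cup\bigcup_{j:\,l(j)=i,\ m^{(j)}\leadsto m\text{ at level }i}V^{(j)}(m^{(j)})$, and $N^{(i)}:=(\bigcup_{j=1}^{\mathfrak n}V^{(i\wedge j)}(m^{(j)}))^c$. *)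

theory Defs
  imports Complex_Main "HOL-Library.Extended_Nat"
begin

section \<open>Transition matrices\<close>

definition transition_matrix :: "('s::finite \<Rightarrow> 's \<Rightarrow> real) \<Rightarrow> bool" where
  "transition_matrix p \<longleftrightarrow> (\<forall>r s. 0 \<le> p r s) \<and> (\<forall>r. (\<Sum>s\<in>UNIV. p r s) = 1)"

primrec n_step :: "('s::finite \<Rightarrow> 's \<Rightarrow> real) \<Rightarrow> nat \<Rightarrow> 's \<Rightarrow> 's \<Rightarrow> real" where
  "n_step p 0 r s = (if r = s then 1 else 0)"
| "n_step p (Suc k) r s = (\<Sum>u\<in>UNIV. p r u * n_step p k u s)"

definition irreducible_matrix :: "('s::finite \<Rightarrow> 's \<Rightarrow> real) \<Rightarrow> bool" where
  "irreducible_matrix p \<longleftrightarrow> (\<forall>r s. \<exists>k. 0 < n_step p k r s)"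

definition neighbours :: "('s \<Rightarrow> 's \<Rightarrow> real) \<Rightarrow> 's \<Rightarrow> 's \<Rightarrow> bool" where
  "neighbours p r s \<longleftrightarrow> r \<noteq> s \<and> 0 < p r s"

section \<open>Minimal paths and essential saddles\<close>

text \<open>A path is the list of its states. The set is only meant for \<open>r \<noteq> s\<close>;
  for \<open>r = s\<close> it is the singleton of the trivial path.\<close>

definition paths :: "('s \<Rightarrow> 's \<Rightarrow> real) \<Rightarrow> 's \<Rightarrow> 's \<Rightarrow> 's list set" where
  "paths p r s = {\<gamma>. \<gamma> \<noteq> [] \<and> hd \<gamma> = r \<and> last \<gamma> = s \<and> distinct \<gamma> \<and>
                     successively (\<lambda>x y. 0 < p x y) \<gamma>}"

definition max_energy :: "('s \<Rightarrow> real) \<Rightarrow> 's list \<Rightarrow> real" where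
  "max_energy E \<gamma> = Max (E ` set \<gamma>)"

definition minimal_path :: "('s \<Rightarrow> real) \<Rightarrow> ('s \<Rightarrow> 's \<Rightarrow> real) \<Rightarrow> 's \<Rightarrow> 's \<Rightarrow> 's list \<Rightarrow> bool" where
  "minimal_path E p r s \<gamma> \<longleftrightarrow> is_arg_min (max_energy E) (\<lambda>\<gamma>'. \<gamma>' \<in> paths p r s) \<gamma>"

definition saddle :: "('s \<Rightarrow> real) \<Rightarrow> ('s \<Rightarrow> 's \<Rightarrow> real) \<Rightarrow> 's \<Rightarrow> 's \<Rightarrow> 's" where
  "saddle E p r s =
     (if r = s then s
      else (THE z. \<exists>\<gamma>. minimal_path E p r s \<gamma> \<and> z \<in> set \<gamma> \<and> E z = max_energy E \<gamma>))"

section \<open>Metastable states\<close>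

definition local_minima :: "('s \<Rightarrow> real) \<Rightarrow> ('s \<Rightarrow> 's \<Rightarrow> real) \<Rightarrow> 's set" where
  "local_minima E p = {s. \<forall>r. neighbours p r s \<longrightarrow> E s < E r}"

definition num_metastable :: "('s \<Rightarrow> real) \<Rightarrow> ('s \<Rightarrow> 's \<Rightarrow> real) \<Rightarrow> nat" where
  "num_metastable E p = card (local_minima E p)"

text \<open>\<open>metastable E p \<mu> i\<close> is \<open>M\<^sup>(\<^sup>i\<^sup>)\<close>, where \<open>\<mu> i\<close> stands for the removed state \<open>m\<^sup>(\<^sup>i\<^sup>)\<close>.
  Levels start at 1; level 0 is a dummy.\<close>

fun metastable ::
    "('s \<Rightarrow> real) \<Rightarrow> ('s \<Rightarrow> 's \<Rightarrow> real) \<Rightarrow> (nat \<Rightarrow> 's) \<Rightarrow> nat \<Rightarrow> 's set" where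
  "metastable E p \<mu> 0 = {}"
| "metastable E p \<mu> (Suc 0) = local_minima E p"
| "metastable E p \<mu> (Suc (Suc i)) = metastable E p \<mu> (Suc i) - {\<mu> (Suc i)}"

definition activation_energy ::
    "('s \<Rightarrow> real) \<Rightarrow> ('s \<Rightarrow> 's \<Rightarrow> real) \<Rightarrow> 's set \<Rightarrow> 's \<Rightarrow> real" where
  "activation_energy E p M m = Min ((\<lambda>n. E (saddle E p m n)) ` (M - {m})) - E m"

text \<open>Since ties are broken arbitrarily, an enumeration of the metastable states is not
  a function of \<open>E\<close> and \<open>p\<close>; this predicate describes all admissible ones.\<close>

definition metastable_enumeration ::
    "('s \<Rightarrow> real) \<Rightarrow> ('s \<Rightarrow> 's \<Rightarrow> real) \<Rightarrow> (nat \<Rightarrow> 's) \<Rightarrow> bool" where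
  "metastable_enumeration E p \<mu> \<longleftrightarrow>
     (\<forall>i. 1 \<le> i \<and> i < num_metastable E p \<longrightarrow>
        is_arg_min (activation_energy E p (metastable E p \<mu> i))
                   (\<lambda>m. m \<in> metastable E p \<mu> i) (\<mu> i)) \<and>
     metastable E p \<mu> (num_metastable E p) = {\<mu> (num_metastable E p)}"

section \<open>Attraction\<close>

text \<open>Below, \<open>M\<close> is the set of metastable states at the level under consideration.\<close>

definition strict_basin ::
    "('s \<Rightarrow> real) \<Rightarrow> ('s \<Rightarrow> 's \<Rightarrow> real) \<Rightarrow> 's set \<Rightarrow> 's \<Rightarrow> 's set" where
  "strict_basin E p M m = {s. \<forall>m'\<in>M - {m}. E (saddle E p s m) < E (saddle E p s m')}"

definition attracted ::
    "('s \<Rightarrow> real) \<Rightarrow> ('s \<Rightarrow> 's \<Rightarrow> real) \<Rightarrow> 's set \<Rightarrow> 's \<Rightarrow> 's \<Rightarrow> bool" where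
  "attracted E p M s m \<longleftrightarrow>
     m \<in> M \<and>
     E (saddle E p s m) = Min ((\<lambda>n. E (saddle E p s n)) ` M) \<and>
     (\<forall>m'\<in>M - {m}. E (saddle E p s m') = E (saddle E p s m) \<longrightarrow>
        (\<forall>\<gamma>. minimal_path E p s m' \<gamma> \<longrightarrow> set \<gamma> \<inter> strict_basin E p M m \<noteq> {}))"

definition attraction_level ::
    "('s \<Rightarrow> real) \<Rightarrow> ('s \<Rightarrow> 's \<Rightarrow> real) \<Rightarrow> (nat \<Rightarrow> 's) \<Rightarrow> nat \<Rightarrow> enat" where
  "attraction_level E p \<mu> i =
     Inf (enat ` {j. i < j \<and> j \<le> num_metastable E p \<and>
                     (\<exists>m\<in>metastable E p \<mu> j. attracted E p (metastable E p \<mu> j) (\<mu> i) m)})"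

section \<open>Valleys\<close>

text \<open>\<open>valley E p \<mu> i m\<close> is \<open>V\<^sup>(\<^sup>i\<^sup>)(m)\<close> and is meant for \<open>m \<in> metastable E p \<mu> i\<close>;
  \<open>residual E p \<mu> i\<close> is \<open>N\<^sup>(\<^sup>i\<^sup>)\<close>. The bound \<open>j \<le> Suc i\<close> only serves termination: it is
  implied by \<open>attraction_level E p \<mu> j = enat (Suc (Suc i))\<close>.\<close>

fun valley ::
      "('s \<Rightarrow> real) \<Rightarrow> ('s \<Rightarrow> 's \<Rightarrow> real) \<Rightarrow> (nat \<Rightarrow> 's) \<Rightarrow> nat \<Rightarrow> 's \<Rightarrow> 's set"
  and residual ::
      "('s \<Rightarrow> real) \<Rightarrow> ('s \<Rightarrow> 's \<Rightarrow> real) \<Rightarrow> (nat \<Rightarrow> 's) \<Rightarrow> nat \<Rightarrow> 's set" where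
  "valley E p \<mu> 0 m = {}"
| "valley E p \<mu> (Suc 0) m = {s. attracted E p (metastable E p \<mu> 1) s m}"
| "valley E p \<mu> (Suc (Suc i)) m =
     valley E p \<mu> (Suc i) m \<union>
     {s \<in> residual E p \<mu> (Suc i). attracted E p (metastable E p \<mu> (Suc (Suc i))) s m} \<union>
     (\<Union>j\<in>{j. 1 \<le> j \<and> j \<le> Suc i \<and> attraction_level E p \<mu> j = enat (Suc (Suc i)) \<and>
               attracted E p (metastable E p \<mu> (Suc (Suc i))) (\<mu> j) m}.
        valley E p \<mu> j (\<mu> j))"
| "residual E p \<mu> i = - (\<Union>j\<in>{1..num_metastable E p}. valley E p \<mu> (min i j) (\<mu> j))"

end

theory Submission
  imports Defs
begin

text \<open>
  The chain \<^term>\<open>valley E p \<mu> k m \<subseteq> valley E p \<mu> (Suc k) m\<close> is immediate, because each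
  valley is defined by enlarging the previous one. The content is the nesting property: a valley
  which swallows a metastable state \<open>m\<close> swallows the valley of \<open>m\<close> as well.

  A state enters the valley of \<open>n\<close> in one of three ways: by attraction at level 1, out of the
  residual set at a later level, or as part of the complete valley \<open>V\<^sup>(\<^sup>k\<^sup>)(\<mu> k)\<close> of a removed
  state. A local minimum \<open>m \<noteq> n\<close> can only enter in the third way. Every path that leaves \<open>m\<close>
  climbs at its first step, so every essential saddle between \<open>m\<close> and another state is strictly
  higher than \<open>m\<close>. Hence \<open>m\<close> is attracted by itself and by nothing else at level 1, which excludes
  the first way; and \<open>m\<close> lies in its own valley at every level, so it is never in the residual
  set, which excludes the second. This is \<open>foreign_minimum_via_removed_valley\<close>.

  The rest is bookkeeping. If \<open>m\<close> entered \<open>V\<^sup>(\<^sup>j\<^sup>)(n)\<close> together with \<open>V\<^sup>(\<^sup>k\<^sup>)(\<mu> k)\<close>, where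
  \<open>k < j\<close>, then either \<open>m = \<mu> k\<close>, and the valley of \<open>m\<close> up to its removal was added as a whole;
  or \<open>m\<close> is again a foreign minimum of \<open>V\<^sup>(\<^sup>k\<^sup>)(\<mu> k)\<close>, and one descends to the smaller level
  \<open>k\<close>. The descent needs \<open>m\<close> to have a valley at a level below \<open>k\<close>, and this is
  \<open>foreign_minimum_not_metastable\<close>: a minimum lying in a foreign valley has already been removed.
\<close>

section \<open>Essential saddles above a local minimum\<close>

lemma path_if_n_step_pos:
  assumes "transition_matrix p" and "0 < n_step p k r s"
  shows "paths p r s \<noteq> {}"
  using assms(2)
proof (induction k arbitrary: r)
  case 0
  then have "[r] \<in> paths p r s"
    by (auto simp: paths_def split: if_splits)
  then show ?case by blast
next
  case (Suc k)
  have "\<exists>u. 0 < p r u * n_step p k u s"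
  proof (rule ccontr)
    assume "\<nexists>u. 0 < p r u * n_step p k u s"
    then have "(\<Sum>u\<in>UNIV. p r u * n_step p k u s) \<le> 0"
      by (intro sum_nonpos) (simp add: not_less)
    then show False
      using Suc.prems by simp
  qed
  then obtain u where u: "0 < p r u * n_step p k u s"
    by blast
  moreover have "0 \<le> p r u"
    using assms(1) by (simp add: transition_matrix_def)
  ultimately have pru: "0 < p r u" and nu: "0 < n_step p k u s"
    by (auto simp: zero_less_mult_iff)
  from Suc.IH[OF nu] obtain \<gamma> where \<gamma>: "\<gamma> \<in> paths p u s"
    by blast
  show ?case
  proof (cases "r \<in> set \<gamma>")
    case True
    \<comment> \<open>Prepending \<open>r\<close> would create a loop, so the path is cut at \<open>r\<close> instead.\<close>
    then obtain xs ys where "\<gamma> = xs @ r # ys"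
      by (meson split_list)
    then have "r # ys \<in> paths p r s"
      using \<gamma> by (auto simp: paths_def successively_append_iff)
    then show ?thesis by blast
  next
    case False
    then have "r # \<gamma> \<in> paths p r s"
      using \<gamma> pru by (cases \<gamma>) (auto simp: paths_def)
    then show ?thesis by blast
  qed
qed

lemma finite_paths: "finite (paths p r (s::'s::finite))"
  by (rule finite_subset[OF _ finite_subset_distinct[of UNIV]]) (auto simp: paths_def)

lemma saddle_on_minimal_path:
  fixes E :: "'s::finite \<Rightarrow> real"
  assumes "inj E" and "paths p r s \<noteq> {}" and "r \<noteq> s"
  shows "\<exists>\<gamma>. minimal_path E p r s \<gamma> \<and> saddle E p r s \<in> set \<gamma> \<and>
             E (saddle E p r s) = max_energy E \<gamma>"
proof -
  let ?Q = "\<lambda>z. \<exists>\<gamma>. minimal_path E p r s \<gamma> \<and> z \<in> set \<gamma> \<and> E z = max_energy E \<gamma>"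
  obtain \<gamma> where \<gamma>: "minimal_path E p r s \<gamma>"
    using ex_is_arg_min_if_finite[OF finite_paths assms(2)] unfolding minimal_path_def by blast
  then have "\<gamma> \<noteq> []"
    by (auto simp: minimal_path_def is_arg_min_def paths_def)
  then have "max_energy E \<gamma> \<in> E ` set \<gamma>"
    unfolding max_energy_def by (intro Max_in) auto
  then obtain z where z: "?Q z"
    using \<gamma> by force
  have "y = z" if "?Q y" for y
  proof -
    have "E y = E z"
      using that z unfolding minimal_path_def is_arg_min_linorder by (metis order_antisym)
    then show ?thesis
      using assms(1) by (simp add: inj_eq)
  qed
  with z have "?Q (THE z. ?Q z)"
    by (rule theI)
  then show ?thesis
    using assms(3) by (simp add: saddle_def)
qed

text \<open>The first step out of a local minimum already climbs, and the essential saddle is the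
  highest state of a path.\<close>

lemma saddle_above_local_minimum:
  fixes E :: "'s::finite \<Rightarrow> real"
  assumes "inj E" and "transition_matrix p" and "irreducible_matrix p"
    and sym: "\<And>r s. 0 < p r s \<longleftrightarrow> 0 < p s r"
    and m: "m \<in> local_minima E p" and "m \<noteq> s"
  shows "E m < E (saddle E p m s)"
proof -
  have "paths p m s \<noteq> {}"
    using path_if_n_step_pos[OF assms(2)] assms(3) unfolding irreducible_matrix_def by blast
  then obtain \<gamma> where \<gamma>: "minimal_path E p m s \<gamma>" "E (saddle E p m s) = max_energy E \<gamma>"
    using saddle_on_minimal_path[OF assms(1) _ \<open>m \<noteq> s\<close>] by blast
  then have path: "\<gamma> \<in> paths p m s"
    by (simp add: minimal_path_def is_arg_min_def)
  then obtain y ys where y: "\<gamma> = m # y # ys" "m \<noteq> y" "0 < p m y"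
    using \<open>m \<noteq> s\<close> by (cases \<gamma> rule: remdups_adj.cases) (auto simp: paths_def)
  then have "E m < E y"
    using m sym by (auto simp: local_minima_def neighbours_def)
  also have "E y \<le> max_energy E \<gamma>"
    unfolding max_energy_def using y(1) by (intro Max_ge) auto
  finally show ?thesis
    using \<gamma>(2) by simp
qed

text \<open>The minimum over \<open>M\<close> in the definition of attraction is \<open>E m\<close> here, and it is attained only
  by the essential saddle of \<open>m\<close> and itself. So there is no competitor left whose minimal paths
  would have to be examined.\<close>

lemma local_minimum_attracted_iff:
  fixes E :: "'s::finite \<Rightarrow> real"
  assumes "inj E" and "transition_matrix p" and "irreducible_matrix p"
    and "\<And>r s. 0 < p r s \<longleftrightarrow> 0 < p s r"
    and "m \<in> local_minima E p" and "m \<in> M"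
  shows "attracted E p M m n \<longleftrightarrow> n = m"
proof -
  have self: "E (saddle E p m m) = E m"
    by (simp add: saddle_def)
  have above: "E m < E (saddle E p m s)" if "s \<noteq> m" for s
    using saddle_above_local_minimum[OF assms(1-5), of s] that by simp
  have "Min ((\<lambda>n. E (saddle E p m n)) ` M) = E m"
  proof (rule Min_eqI)
    show "E m \<le> e" if "e \<in> (\<lambda>n. E (saddle E p m n)) ` M" for e
    proof -
      obtain n where "e = E (saddle E p m n)"
        using \<open>e \<in> _\<close> by blast
      then show ?thesis
        using above[of n] self by (cases "n = m") simp_all
    qed
    show "E m \<in> (\<lambda>n. E (saddle E p m n)) ` M"
      using self assms(6) by (intro image_eqI[of _ _ m]) simp_all
  qed simp
  then show ?thesis
    unfolding attracted_def using above[of n] self assms(6)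
    by (cases "n = m") (auto dest: less_imp_neq[OF above])
qed

section \<open>The enumeration of the metastable states\<close>

lemma metastable_antimono:
  assumes "1 \<le> i" and "i \<le> j"
  shows "metastable E p \<mu> j \<subseteq> metastable E p \<mu> i"
  using assms(2)
proof (induction rule: dec_induct)
  case (step k)
  then show ?case
    using assms(1) by (cases k) auto
qed simp

lemma removed_not_metastable:
  assumes "1 \<le> k" and "k < j"
  shows "\<mu> k \<notin> metastable E p \<mu> j"
proof -
  have "\<mu> k \<notin> metastable E p \<mu> (Suc k)"
    using assms(1) by (cases k) auto
  then show ?thesis
    using metastable_antimono[of "Suc k" j E p \<mu>] assms by auto
qed

lemma local_minimum_enumerated:
  fixes E :: "'s::finite \<Rightarrow> real"
  assumes "metastable_enumeration E p \<mu>" and m: "m \<in> local_minima E p"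
  obtains k where "1 \<le> k" and "k \<le> num_metastable E p" and "m = \<mu> k"
proof -
  have split: "m \<in> metastable E p \<mu> (Suc k) \<union> \<mu> ` {1..k}" for k
    by (induction k) (use m in \<open>auto simp: atLeastAtMostSuc_conv\<close>)
  have pos: "1 \<le> num_metastable E p"
    using m unfolding num_metastable_def by (simp add: Suc_le_eq card_gt_0_iff) blast
  then obtain h where h: "num_metastable E p = Suc h"
    by (cases "num_metastable E p") auto
  have "metastable E p \<mu> (Suc h) = {\<mu> (Suc h)}"
    using assms(1) h by (simp add: metastable_enumeration_def)
  with split[of h] consider "m = \<mu> (Suc h)" | k where "k \<in> {1..h}" "m = \<mu> k"
    by auto
  then show thesis
    using that h by cases auto
qed

section \<open>Valleys\<close>

lemma valley_mono:
  assumes "i \<le> j"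
  shows "valley E p \<mu> i m \<subseteq> valley E p \<mu> j m"
  using assms
proof (induction rule: dec_induct)
  case (step k)
  then show ?case
    by (cases k) auto
qed simp

lemma local_minimum_in_own_valley:
  fixes E :: "'s::finite \<Rightarrow> real"
  assumes "inj E" and "transition_matrix p" and "irreducible_matrix p"
    and "\<And>r s. 0 < p r s \<longleftrightarrow> 0 < p s r"
    and "m \<in> local_minima E p" and "1 \<le> i"
  shows "m \<in> valley E p \<mu> i m"
proof -
  have "m \<in> valley E p \<mu> 1 m"
    using local_minimum_attracted_iff[OF assms(1-5)] assms(5) by simp
  then show ?thesis
    by (rule subsetD[OF valley_mono[OF assms(6)]])
qed

text \<open>Of the three ways into a valley, a foreign local minimum is left only with the one through
  the complete valley of a removed state: at level 1 it is attracted by itself alone, and it never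
  belongs to the residual set because it lies in its own valley.\<close>

lemma foreign_minimum_via_removed_valley:
  fixes E :: "'s::finite \<Rightarrow> real"
  assumes "inj E" and "transition_matrix p" and "irreducible_matrix p"
    and "\<And>r s. 0 < p r s \<longleftrightarrow> 0 < p s r"
    and "metastable_enumeration E p \<mu>"
    and m: "m \<in> local_minima E p" and "m \<noteq> n"
    and "m \<in> valley E p \<mu> j n"
  shows "\<exists>k. 1 \<le> k \<and> k < j \<and> m \<in> valley E p \<mu> k (\<mu> k) \<and>
             valley E p \<mu> k (\<mu> k) \<subseteq> valley E p \<mu> j n"
  using assms(8)
proof (induction j)
  case 0
  then show ?case by simp
next
  case (Suc j)
  show ?case
  proof (cases j)
    case 0
    then show ?thesis
      using Suc.prems local_minimum_attracted_iff[OF assms(1-4) m] m \<open>m \<noteq> n\<close> by simp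
  next
    case j: (Suc i)
    obtain h where h: "1 \<le> h" "h \<le> num_metastable E p" "m = \<mu> h"
      by (rule local_minimum_enumerated[OF assms(5) m])
    have "m \<in> valley E p \<mu> (min j h) (\<mu> h)"
      using local_minimum_in_own_valley[OF assms(1-4) m, of "min j h" \<mu>] h j by simp
    then have "m \<notin> residual E p \<mu> j"
      using h by auto
    with Suc.prems j consider "m \<in> valley E p \<mu> j n"
      | k where "1 \<le> k" "k \<le> j" "attraction_level E p \<mu> k = enat (Suc j)"
          "attracted E p (metastable E p \<mu> (Suc j)) (\<mu> k) n" "m \<in> valley E p \<mu> k (\<mu> k)"
      by auto
    then show ?thesis
    proof cases
      case 1
      then show ?thesis
        using Suc.IH valley_mono[of j "Suc j" E p \<mu> n] by (meson le_SucI less_SucI order_refl subset_trans)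
    next
      case (2 k)
      then have "valley E p \<mu> k (\<mu> k) \<subseteq> valley E p \<mu> (Suc j) n"
        unfolding j by auto
      with 2 show ?thesis
        by (auto simp: less_Suc_eq_le)
    qed
  qed
qed

text \<open>A foreign minimum sits in the valley of some \<open>\<mu> k\<close> with \<open>k < j\<close>. Either it is the removed
  state \<open>\<mu> k\<close> itself, or it is foreign there too and the argument repeats at the smaller level.\<close>

lemma foreign_minimum_not_metastable:
  fixes E :: "'s::finite \<Rightarrow> real"
  assumes "inj E" and "transition_matrix p" and "irreducible_matrix p"
    and "\<And>r s. 0 < p r s \<longleftrightarrow> 0 < p s r"
    and "metastable_enumeration E p \<mu>"
    and m: "m \<in> local_minima E p" and "m \<noteq> n"
    and "m \<in> valley E p \<mu> j n"
  shows "m \<notin> metastable E p \<mu> j"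
  using assms(7,8)
proof (induction j arbitrary: n rule: less_induct)
  case (less j)
  obtain k where k: "1 \<le> k" "k < j" "m \<in> valley E p \<mu> k (\<mu> k)"
    using foreign_minimum_via_removed_valley[OF assms(1-5) m less.prems] by blast
  show ?case
  proof (cases "m = \<mu> k")
    case True
    then show ?thesis
      using removed_not_metastable[OF k(1,2)] by blast
  next
    case False
    then have "m \<notin> metastable E p \<mu> k"
      using less.IH k by blast
    then show ?thesis
      using metastable_antimono[of k j E p \<mu>] k by auto
  qed
qed

text \<open>The descent along removed valleys that contain \<open>m\<close> stops at the removal of \<open>m\<close> itself, and
  the removal does not precede level \<open>i\<close> because \<open>m\<close> is still metastable there.\<close>

lemma valley_of_contained_minimum:
  fixes E :: "'s::finite \<Rightarrow> real"
  assumes "inj E" and "transition_matrix p" and "irreducible_matrix p"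
    and "\<And>r s. 0 < p r s \<longleftrightarrow> 0 < p s r"
    and "metastable_enumeration E p \<mu>"
    and "1 \<le> i" and m: "m \<in> metastable E p \<mu> i"
    and "i \<le> j" and "m \<in> valley E p \<mu> j n"
  shows "valley E p \<mu> i m \<subseteq> valley E p \<mu> j n"
  using assms(8,9)
proof (induction j arbitrary: n rule: less_induct)
  case (less j)
  have min: "m \<in> local_minima E p"
    using subsetD[OF metastable_antimono[OF order_refl assms(6)] m] by simp
  show ?case
  proof (cases "m = n")
    case True
    then show ?thesis
      using valley_mono[OF less.prems(1)] by simp
  next
    case False
    then obtain k where k: "1 \<le> k" "k < j" "m \<in> valley E p \<mu> k (\<mu> k)"
        "valley E p \<mu> k (\<mu> k) \<subseteq> valley E p \<mu> j n"
      using foreign_minimum_via_removed_valley[OF assms(1-5) min _ less.prems(2)] by blast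
    have "i \<le> k"
    proof (rule ccontr)
      assume "\<not> i \<le> k"
      then have "m \<in> metastable E p \<mu> k" and "m \<noteq> \<mu> k"
        using m k(1) metastable_antimono[of k i E p \<mu>] removed_not_metastable[of k i \<mu> E p]
        by auto
      then show False
        using foreign_minimum_not_metastable[OF assms(1-5) min _ k(3)] by blast
    qed
    then show ?thesis
      using less.IH k by blast
  qed
qed

theorem proposition1p12:
  fixes E :: "'s::finite \<Rightarrow> real"
    and p :: "'s \<Rightarrow> 's \<Rightarrow> real"
    and \<mu> :: "nat \<Rightarrow> 's"
  assumes "inj E"
    and "transition_matrix p"
    and "irreducible_matrix p"
    and "\<And>s. 0 < p s s"
    and "\<And>r s. 0 < p r s \<longleftrightarrow> 0 < p s r"
    and "metastable_enumeration E p \<mu>"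
  shows "(\<forall>i m. 1 \<le> i \<and> i \<le> num_metastable E p \<and> m \<in> metastable E p \<mu> i \<longrightarrow>
            (\<forall>k. 1 \<le> k \<and> k < i \<longrightarrow> valley E p \<mu> k m \<subseteq> valley E p \<mu> (Suc k) m)) \<and>
         (\<forall>i j m n. 1 \<le> i \<and> i < j \<and> j \<le> num_metastable E p \<and> n \<in> metastable E p \<mu> j \<and>
            m \<in> metastable E p \<mu> i \<inter> valley E p \<mu> j n \<longrightarrow>
            valley E p \<mu> i m \<subseteq> valley E p \<mu> j n)"
proof (intro conjI allI impI)
  show "valley E p \<mu> k m \<subseteq> valley E p \<mu> (Suc k) m" for k m
    by (rule valley_mono) simp
next
  fix i j m n
  assume "1 \<le> i \<and> i < j \<and> j \<le> num_metastable E p \<and> n \<in> metastable E p \<mu> j \<and>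
            m \<in> metastable E p \<mu> i \<inter> valley E p \<mu> j n"
  then show "valley E p \<mu> i m \<subseteq> valley E p \<mu> j n"
    by (intro valley_of_contained_minimum[OF assms(1,2,3,5,6)]) auto
qed

end
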